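(* Let $\theta\in(0,1)$ and let $q\in\mathcal{P}(\mathbb{R})$ be log-Hölder continuous both at the origin and at infinity with $q(0)=q_\infty$. Then $$(L^1,L_\infty)_{\theta,q(\cdot)}=\mathcal{L}^{p,q(\cdot)}(\mathbb{R}^n),$$ with $p=\frac{1}{1-\theta}$, where $L^1=L^1(\mathbb{R}^n)$ and $L_\infty=L^\infty(\mathbb{R}^n)$.
   Context: For a compatible couple of Banach spaces $(A_0,A_1)$ (both continuously embedded in a common Hausdorff topological vector space), $K(t,f)=\inf_{f=f_0+f_1}(\|f_0\|_{A_0}+t\|f_1\|_{A_1})$ for $t>0$, $f\in A_0+A_1$ (infimum over $f_i\in A_i$). $\mathcal{P}(\mathbb{R})$ is the set of measurable functions $q:\mathbb{R}\to[1,\infty)$. For measurable $g$ on $(0,\infty)$, $\|g\|_{L^{q(\cdot)}((0,\infty),\frac{dt}{t})}=\inf\{\lambda>0:\int_0^\infty|g(t)/\lambda|^{q(t)}\frac{dt}{t}\le1\}$, and $\|g\|_{L^{q(\cdot)}([0,\infty))}$ is defined in the same way with $dt$ in place of $\frac{dt}{t}$. The space $(A_0,A_1)_{\theta,q(\cdot)}$ consists of all $f\in A_0+A_1$ with $\|f\|_{(A_0,A_1)_{\theta,q(\cdot)}}=\|t^{-\theta}K(t,f)\|_{L^{q(\cdot)}((0,\infty),\frac{dt}{t})}<\infty$. $q$ is log-Hölder continuous at the origin if there is $c>0$ with $|q(x)-q(0)|\le c/\ln(e+1/|x|)$ for all $x$; it is log-Hölder continuous at infinity if there are $q_\infty\in\mathbb{R}$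 and $c>0$ with $|q(x)-q_\infty|\le c/\log(e+|x|)$ for all $x$. For measurable $f$ on $\mathbb{R}^n$, $m_f(\lambda)=|\{x\in\mathbb{R}^n:|f(x)|>\lambda\}|$ is the distribution function and $f^*(t)=\sup\{\lambda>0:m_f(\lambda)>t\}$ the non-increasing rearrangement. For $p,q\in\mathcal{P}(\mathbb{R})$, $\mathcal{L}^{p(\cdot),q(\cdot)}(\mathbb{R}^n)$ is the space of functions $f$ on $\mathbb{R}^n$ with $\|f\|_{\mathcal{L}^{p(\cdot),q(\cdot)}(\mathbb{R}^n)}=\big\|t^{\frac1{p(t)}-\frac1{q(t)}}f^*(t)\big\|_{L^{q(\cdot)}([0,\infty))}<\infty$; $\mathcal{L}^{p,q(\cdot)}(\mathbb{R}^n)$ denotes the case of constant $p$. *)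

theory Defs
  imports
    "HOL-Analysis.Analysis"
    "HOL-Probability.Essential_Supremum"
    "HOL-Library.Function_Algebras"
begin

subsection \<open>Spaces, couples and the K-functional\<close>

text \<open>A (quasi-)normed space inside an ambient type is given by its carrier and its norm; values of
  the norm outside the carrier are irrelevant. Function spaces are represented by actual functions
  rather than by classes modulo equality almost everywhere: all carriers and norms below are
  invariant under changes on null sets.\<close>

type_synonym 'v nspace = "'v set \<times> ('v \<Rightarrow> ennreal)"

abbreviation carr :: "'v nspace \<Rightarrow> 'v set" where "carr \<equiv> fst"
abbreviation nrm :: "'v nspace \<Rightarrow> 'v \<Rightarrow> ennreal" where "nrm \<equiv> snd"

definition sum_carrier :: "'v::plus nspace \<Rightarrow> 'v nspace \<Rightarrow> 'v set" where
  "sum_carrier A0 A1 = {f0 + f1 | f0 f1. f0 \<in> carr A0 \<and> f1 \<in> carr A1}"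

definition K_functional :: "'v::plus nspace \<Rightarrow> 'v nspace \<Rightarrow> real \<Rightarrow> 'v \<Rightarrow> ennreal" where
  "K_functional A0 A1 t f =
     Inf {nrm A0 f0 + ennreal t * nrm A1 f1 | f0 f1. f0 \<in> carr A0 \<and> f1 \<in> carr A1 \<and> f = f0 + f1}"

text \<open>Equality of function spaces in the sense of interpolation theory: the same elements, with
  equivalent (quasi-)norms.\<close>

definition same_space :: "'v nspace \<Rightarrow> 'v nspace \<Rightarrow> bool" where
  "same_space X Y \<longleftrightarrow> carr X = carr Y \<and>
     (\<exists>C>0. \<forall>f\<in>carr X. nrm X f \<le> ennreal C * nrm Y f \<and> nrm Y f \<le> ennreal C * nrm X f)"

subsection \<open>Variable exponents\<close>

definition exponents :: "(real \<Rightarrow> real) set" where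
  "exponents = {q \<in> borel_measurable lebesgue. \<forall>x. 1 \<le> q x}"

text \<open>At \<open>x = 0\<close> the left-hand side vanishes, so the convention \<open>1 / 0 = 0\<close> is harmless.\<close>

definition log_hoelder_origin :: "(real \<Rightarrow> real) \<Rightarrow> bool" where
  "log_hoelder_origin q \<longleftrightarrow> (\<exists>c>0. \<forall>x. \<bar>q x - q 0\<bar> \<le> c / ln (exp 1 + 1 / \<bar>x\<bar>))"

definition log_hoelder_infinity :: "(real \<Rightarrow> real) \<Rightarrow> real \<Rightarrow> bool" where
  "log_hoelder_infinity q qinf \<longleftrightarrow> (\<exists>c>0. \<forall>x. \<bar>q x - qinf\<bar> \<le> c / ln (exp 1 + \<bar>x\<bar>))"

text \<open>Real powers of extended nonnegative numbers, meant for exponents \<open>a > 0\<close>.\<close>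

definition ennpowr :: "ennreal \<Rightarrow> real \<Rightarrow> ennreal" where
  "ennpowr x a = (if x = \<infinity> then \<infinity> else ennreal (enn2real x powr a))"

text \<open>The Luxemburg norm of a function with values in \<open>[0, \<infinity>]\<close>; it is \<open>\<infinity>\<close> if no \<open>s\<close> is admissible.\<close>

definition var_norm :: "real measure \<Rightarrow> (real \<Rightarrow> real) \<Rightarrow> (real \<Rightarrow> ennreal) \<Rightarrow> ennreal" where
  "var_norm M q g =
     Inf {ennreal s | s. s > 0 \<and> (\<integral>\<^sup>+ t. ennpowr (g t / ennreal s) (q t) \<partial>M) \<le> 1}"

definition dt_measure :: "real measure" where
  "dt_measure = restrict_space lebesgue {0..}"

definition dt_over_t_measure :: "real measure" where
  "dt_over_t_measure = density (restrict_space lebesgue {0<..}) (\<lambda>t. ennreal (1 / t))"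

subsection \<open>Interpolation and Lorentz spaces\<close>

definition var_interp :: "'v::plus nspace \<Rightarrow> 'v nspace \<Rightarrow> real \<Rightarrow> (real \<Rightarrow> real) \<Rightarrow> 'v nspace" where
  "var_interp A0 A1 \<theta> q =
     (let N = (\<lambda>f. var_norm dt_over_t_measure q (\<lambda>t. ennreal (t powr (- \<theta>)) * K_functional A0 A1 t f))
      in ({f \<in> sum_carrier A0 A1. N f < \<infinity>}, N))"

definition L1_space :: "(real ^ 'n \<Rightarrow> 'b::{banach, second_countable_topology}) nspace" where
  "L1_space = ({f. integrable lebesgue f}, \<lambda>f. \<integral>\<^sup>+ x. ennreal (norm (f x)) \<partial>lebesgue)"

definition Linf_space :: "(real ^ 'n \<Rightarrow> 'b::real_normed_vector) nspace" where
  "Linf_space =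
     (let N = (\<lambda>f. esssup lebesgue (\<lambda>x. ennreal (norm (f x))))
      in ({f \<in> borel_measurable lebesgue. N f < \<infinity>}, N))"

definition distribution_fun :: "(real ^ 'n \<Rightarrow> 'b::real_normed_vector) \<Rightarrow> real \<Rightarrow> ennreal" where
  "distribution_fun f s = emeasure lebesgue {x. norm (f x) > s}"

text \<open>The supremum is taken in \<open>[0, \<infinity>]\<close>, so it is \<open>0\<close> for the empty set.\<close>

definition rearrangement :: "(real ^ 'n \<Rightarrow> 'b::real_normed_vector) \<Rightarrow> real \<Rightarrow> ennreal" where
  "rearrangement f t = Sup {ennreal s | s. s > 0 \<and> distribution_fun f s > ennreal t}"

definition var_lorentz ::
  "(real \<Rightarrow> real) \<Rightarrow> (real \<Rightarrow> real) \<Rightarrow> (real ^ 'n \<Rightarrow> 'b::real_normed_vector) nspace" where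
  "var_lorentz p q =
     (let N = (\<lambda>f. var_norm dt_measure q (\<lambda>t. ennreal (t powr (1 / p t - 1 / q t)) * rearrangement f t))
      in ({f \<in> borel_measurable lebesgue. N f < \<infinity>}, N))"

end

theory Submission
  imports Defs
begin

text \<open>The \<open>K\<close>-functional of the couple is comparable to a dyadic sum:
  \<open>t f\<^sup>*(t) \<le> K(t, f) \<le> 2 (\<Sum>k. (t/2\<^sup>k) f\<^sup>*(t/2\<^bsup>k+1\<^esup>))\<close>. The lower bound gives one norm inequality
  directly; the other one is a Hardy inequality for the exponent \<open>q\<close>, which is reduced to the
  constant exponent \<open>q\<^sub>\<infinity>\<close>. Since \<open>f\<^sup>*\<close> is non-increasing, a modular bound forces
  \<open>G(t) = t\<^bsup>1-\<theta>\<^esup> f\<^sup>*(t)\<close> to be bounded, so after scaling \<open>0 \<le> G \<le> 1\<close>. Log-Hoelder continuity at both ends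
  says that \<open>\<bar>q(t) - q\<^sub>\<infinity>\<bar> \<bar>ln t\<bar>\<close> is bounded; hence \<open>G\<^bsup>q(t)\<^esup>\<close> and \<open>G\<close> to the power \<open>q\<^sub>\<infinity>\<close> are comparable
  where \<open>G \<ge> min t (1/t)\<close>, and elsewhere both are at most \<open>min t (1/t)\<close>, which is integrable for \<open>dt/t\<close>.
  For a constant exponent, the dyadic Hardy inequality follows from the dilation invariance of \<open>dt/t\<close>.\<close>

subsection \<open>Integrals with respect to \<open>dt/t\<close>\<close>

lemma nn_integral_dt_over_t:
  assumes "h \<in> borel_measurable lebesgue"
  shows "(\<integral>\<^sup>+ t. h t \<partial>dt_over_t_measure) = (\<integral>\<^sup>+ t. ennreal (1 / t) * h t \<partial>lebesgue)"
proof -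
  have "(\<integral>\<^sup>+ t. h t \<partial>dt_over_t_measure) =
      (\<integral>\<^sup>+ t. ennreal (1 / t) * h t \<partial>restrict_space lebesgue {0<..})"
    unfolding dt_over_t_measure_def using assms
    by (intro nn_integral_density measurable_restrict_space1) (auto intro: measurable_completion)
  also have "\<dots> = (\<integral>\<^sup>+ t. ennreal (1 / t) * h t * indicator {0<..} t \<partial>lebesgue)"
    by (subst nn_integral_restrict_space) auto
  also have "\<dots> = (\<integral>\<^sup>+ t. ennreal (1 / t) * h t \<partial>lebesgue)"
    \<comment> \<open>For \<open>t \<le> 0\<close> the weight \<open>ennreal (1 / t)\<close> is 0:
      negative reals are truncated and \<open>1 / 0 = 0\<close>. The indicator can therefore be
      dropped.\<close>
    by (intro nn_integral_cong) (auto simp: indicator_def ennreal_neg)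
  finally show ?thesis .
qed

lemma borel_measurable_dt_over_t:
  assumes "h \<in> borel_measurable lebesgue"
  shows "h \<in> borel_measurable dt_over_t_measure"
  using assms unfolding dt_over_t_measure_def
  by (simp add: measurable_restrict_space1)

lemma space_dt_over_t: "space dt_over_t_measure = {0<..}"
  by (simp add: dt_over_t_measure_def space_restrict_space)

text \<open>\<open>dt/t\<close> is the Haar measure of the multiplicative group: the Jacobian
  \<open>1 / d\<close> cancels against the factor \<open>d\<close> coming from the weight. Borel
  measurability of \<open>h\<close> lets the affine substitution be carried out for
  \<open>lborel\<close>.\<close>

lemma nn_integral_dt_over_t_dilation:
  assumes [measurable]: "h \<in> borel_measurable borel" and d: "d > 0"
  shows "(\<integral>\<^sup>+ t. h (t / d) \<partial>dt_over_t_measure) = (\<integral>\<^sup>+ t. h t \<partial>dt_over_t_measure)"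
proof -
  have "(\<integral>\<^sup>+ t. h t \<partial>dt_over_t_measure) = (\<integral>\<^sup>+ t. ennreal (1 / t) * h t \<partial>lborel)"
    using assms by (subst nn_integral_dt_over_t) (auto simp: nn_integral_completion intro: measurable_completion)
  also have "\<dots> = ennreal \<bar>1 / d\<bar> * (\<integral>\<^sup>+ t. ennreal (1 / (0 + 1 / d * t)) * h (0 + 1 / d * t) \<partial>lborel)"
    using d by (intro nn_integral_real_affine) auto
  also have "\<dots> = (\<integral>\<^sup>+ t. ennreal (1 / d) * (ennreal (d / t) * h (t / d)) \<partial>lborel)"
    using d by (subst nn_integral_cmult[symmetric]) auto
  also have "\<dots> = (\<integral>\<^sup>+ t. ennreal (1 / t) * h (t / d) \<partial>lborel)"
    using d by (simp add: mult.assoc[symmetric] ennreal_mult'[symmetric])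
  also have "\<dots> = (\<integral>\<^sup>+ t. h (t / d) \<partial>dt_over_t_measure)"
  proof -
    have [measurable]: "(\<lambda>t. h (t / d)) \<in> borel_measurable borel" by measurable
    then have "(\<lambda>t. h (t / d)) \<in> borel_measurable lebesgue"
      by (intro measurable_completion) simp
    then show ?thesis by (simp add: nn_integral_dt_over_t nn_integral_completion)
  qed
  finally show ?thesis ..
qed

text \<open>After multiplication by \<open>1 / t\<close> the integrand is 1 on \<open>(0, 1]\<close>
  and \<open>1 / t ^ 2\<close> beyond, and each piece contributes 1. The value 2 is the additive
  error of every change of exponent.\<close>

lemma nn_integral_dt_over_t_min:
  "(\<integral>\<^sup>+ t. ennreal (min t (1 / t)) \<partial>dt_over_t_measure) \<le> 2"
proof -
  have "(\<integral>\<^sup>+ t. ennreal (min t (1 / t)) \<partial>dt_over_t_measure) =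
      (\<integral>\<^sup>+ t. ennreal (1 / t) * ennreal (min t (1 / t)) \<partial>lborel)"
    by (subst nn_integral_dt_over_t) (auto simp: nn_integral_completion intro: measurable_completion)
  also have "\<dots> \<le> (\<integral>\<^sup>+ t. indicator {0..1} t + ennreal (1 / t ^ 2) * indicator {1..} t \<partial>lborel)"
  proof (intro nn_integral_mono)
    fix t :: real
    consider "t \<le> 0" | "0 < t" "t \<le> 1" | "1 < t" by linarith
    then show "ennreal (1 / t) * ennreal (min t (1 / t)) \<le> indicator {0..1} t + ennreal (1 / t ^ 2) * indicator {1..} t"
    proof cases
      case 1
      then show ?thesis by (simp add: ennreal_neg)
    next
      case 2
      then have "t \<le> 1 / t" by (simp add: field_simps mult_le_one)
      with 2 show ?thesis by (simp add: ennreal_mult'[symmetric] min_def)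
    next
      case 3
      then have "1 < t * t" by (simp add: less_1_mult)
      with 3 have "1 / t < t" by (simp add: field_simps)
      with 3 show ?thesis by (simp add: ennreal_mult'[symmetric] min_def power2_eq_square)
    qed
  qed
  also have "\<dots> = (\<integral>\<^sup>+ t. indicator {0..1::real} t \<partial>lborel) + (\<integral>\<^sup>+ t. ennreal (1 / t ^ 2) * indicator {1..} t \<partial>lborel)"
    by (intro nn_integral_add) auto
  also have "(\<integral>\<^sup>+ t. ennreal (1 / t ^ 2) * indicator {1::real..} t \<partial>lborel) = ennreal (0 - (- (1 / 1)))"
  proof (rule nn_integral_FTC_atLeast[where F = "\<lambda>x. - (1 / x)"])
    fix x :: real assume "1 \<le> x"
    then show "((\<lambda>x. - (1 / x)) has_real_derivative 1 / x ^ 2) (at x)"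
      by (auto intro!: derivative_eq_intros simp: power2_eq_square)
  next
    show "((\<lambda>x::real. - (1 / x)) \<longlongrightarrow> 0) at_top"
      using tendsto_minus[OF tendsto_inverse_0_at_top[OF filterlim_ident]]
      by (simp add: inverse_eq_divide)
  qed auto
  also have "(\<integral>\<^sup>+ t. indicator {0..1::real} t \<partial>lborel) + ennreal (0 - (- (1 / 1))) = 2"
    by simp
  finally show ?thesis by simp
qed

section \<open>Changing the exponent in a modular\<close>

text \<open>If \<open>x < min t (1 / t)\<close>, then \<open>x powr a \<le> x\<close> because
  \<open>a \<ge> 1\<close>. Otherwise \<open>\<bar>ln x\<bar> \<le> \<bar>ln t\<bar>\<close>, so the
  quotient of the two powers, \<open>exp ((a - b) * ln x)\<close>, is at most
  \<open>exp c\<close>.\<close>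

lemma powr_le_powr_plus_min:
  fixes x t a b c :: real
  assumes x: "0 \<le> x" "x \<le> 1" and t: "0 < t" and a: "1 \<le> a" and c: "\<bar>a - b\<bar> * \<bar>ln t\<bar> \<le> c"
  shows "x powr a \<le> exp c * x powr b + min t (1 / t)"
proof (cases "x < min t (1 / t)")
  case True
  have "x powr a \<le> x powr 1" using x a by (intro powr_mono') auto
  then have "x powr a \<le> min t (1 / t)" using True x by simp
  then show ?thesis by (simp add: add_increasing)
next
  case False
  have min0: "min t (1 / t) > 0" using t by simp
  then have x0: "x > 0" using False by linarith
  have "ln (min t (1 / t)) \<ge> - \<bar>ln t\<bar>" using t by (auto simp: min_def ln_div)
  moreover have "ln (min t (1 / t)) \<le> ln x" using False x0 min0 by (simp only: not_less ln_le_cancel_iff)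
  moreover have "ln x \<le> 0" using x x0 by simp
  ultimately have lx: "\<bar>ln x\<bar> \<le> \<bar>ln t\<bar>" by linarith
  have "(a - b) * ln x \<le> \<bar>a - b\<bar> * \<bar>ln x\<bar>" by (metis abs_ge_self abs_mult)
  also have "\<dots> \<le> \<bar>a - b\<bar> * \<bar>ln t\<bar>" using lx by (intro mult_left_mono) auto
  finally have "(a - b) * ln x \<le> c" using c by simp
  then have "exp ((a - b) * ln x) * x powr b \<le> exp c * x powr b" by (intro mult_right_mono) auto
  moreover have "x powr a = exp ((a - b) * ln x) * x powr b"
    using x0 by (simp add: powr_def exp_add[symmetric] algebra_simps)
  ultimately show ?thesis using min0 by linarith
qed

text \<open>For \<open>t \<le> 1\<close> the condition at the origin is used with
  \<open>\<bar>ln t\<bar> = ln (1 / t)\<close>, for \<open>t > 1\<close> the one at infinity. The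
  equality \<open>q 0 = qinf\<close> makes both compare \<open>q\<close> with the same
  value.\<close>

lemma log_hoelder_imp_ln_bound:
  assumes "log_hoelder_origin q" "log_hoelder_infinity q qinf" "q 0 = qinf"
  shows "\<exists>c. \<forall>t>0. \<bar>q t - qinf\<bar> * \<bar>ln t\<bar> \<le> c"
proof -
  obtain c1 where c1: "c1 > 0" "\<And>x. \<bar>q x - q 0\<bar> \<le> c1 / ln (exp 1 + 1 / \<bar>x\<bar>)"
    using assms unfolding log_hoelder_origin_def by blast
  obtain c2 where c2: "c2 > 0" "\<And>x. \<bar>q x - qinf\<bar> \<le> c2 / ln (exp 1 + \<bar>x\<bar>)"
    using assms unfolding log_hoelder_infinity_def by blast
  have *: "\<bar>d\<bar> * l \<le> c" if "\<bar>d\<bar> \<le> c / ln (exp 1 + y)" "0 < c" "0 < y" "0 \<le> l" "l \<le> ln y" for d c y l :: real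
  proof -
    have "exp 1 + y > 1" using that(3) by (smt (verit) exp_gt_one)
    then have pos: "ln (exp 1 + y) > 0" by simp
    have "l \<le> ln (exp 1 + y)" using that by (smt (verit) exp_gt_zero ln_mono)
    then have "\<bar>d\<bar> * l \<le> c / ln (exp 1 + y) * ln (exp 1 + y)"
      using that pos by (intro mult_mono) auto
    then show ?thesis using pos by simp
  qed
  have "\<bar>q t - qinf\<bar> * \<bar>ln t\<bar> \<le> max c1 c2" if "t > 0" for t
  proof (cases "t \<le> 1")
    case True
    then have "\<bar>q t - qinf\<bar> * \<bar>ln t\<bar> \<le> c1" using c1(1) c1(2)[of t] that assms(3)
      by (intro *[of _ _ "1 / t"]) (auto simp: ln_div)
    then show ?thesis by simp
  next
    case False
    then have "\<bar>q t - qinf\<bar> * \<bar>ln t\<bar> \<le> c2" using c2(1) c2(2)[of t] that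
      by (intro *[of _ _ t]) auto
    then show ?thesis by simp
  qed
  then show ?thesis by blast
qed

text \<open>Integrated form of \<open>powr_le_powr_plus_min\<close>. It serves in both directions,
  from \<open>q\<close> to \<open>qinf\<close> and back.\<close>

lemma modular_exponent_change:
  assumes a[measurable]: "a \<in> borel_measurable lebesgue" and b[measurable]: "b \<in> borel_measurable lebesgue"
    and G[measurable]: "G \<in> borel_measurable lebesgue"
    and a1: "\<And>t. 1 \<le> a t" and c: "\<And>t. 0 < t \<Longrightarrow> \<bar>a t - b t\<bar> * \<bar>ln t\<bar> \<le> c"
    and G01: "\<And>t. 0 < t \<Longrightarrow> 0 \<le> G t" "\<And>t. 0 < t \<Longrightarrow> G t \<le> 1"
  shows "(\<integral>\<^sup>+ t. ennreal (G t powr a t) \<partial>dt_over_t_measure)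
    \<le> ennreal (exp c) * (\<integral>\<^sup>+ t. ennreal (G t powr b t) \<partial>dt_over_t_measure) + 2"
proof -
  have m1: "(\<lambda>t. ennreal (G t powr b t)) \<in> borel_measurable dt_over_t_measure"
    by (rule borel_measurable_dt_over_t) measurable
  have m2: "(\<lambda>t. ennreal (min t (1 / t))) \<in> borel_measurable dt_over_t_measure"
    by (intro borel_measurable_dt_over_t measurable_completion) measurable
  have "(\<integral>\<^sup>+ t. ennreal (G t powr a t) \<partial>dt_over_t_measure)
    \<le> (\<integral>\<^sup>+ t. ennreal (exp c) * ennreal (G t powr b t) + ennreal (min t (1 / t)) \<partial>dt_over_t_measure)"
  proof (intro nn_integral_mono)
    fix t assume "t \<in> space dt_over_t_measure"
    then have t: "0 < t" by (simp add: space_dt_over_t)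
    have "G t powr a t \<le> exp c * G t powr b t + min t (1 / t)"
      by (rule powr_le_powr_plus_min) (use t G01 a1 c in auto)
    then show "ennreal (G t powr a t) \<le> ennreal (exp c) * ennreal (G t powr b t) + ennreal (min t (1 / t))"
      using t by (simp add: ennreal_mult'[symmetric] ennreal_plus[symmetric] ennreal_leI del: ennreal_plus)
  qed
  also have "\<dots> = ennreal (exp c) * (\<integral>\<^sup>+ t. ennreal (G t powr b t) \<partial>dt_over_t_measure)
      + (\<integral>\<^sup>+ t. ennreal (min t (1 / t)) \<partial>dt_over_t_measure)"
    by (subst nn_integral_add, intro borel_measurable_times_ennreal borel_measurable_const m1, rule m2)
       (simp add: nn_integral_cmult m1)
  also have "\<dots> \<le> ennreal (exp c) * (\<integral>\<^sup>+ t. ennreal (G t powr b t) \<partial>dt_over_t_measure) + 2"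
    by (intro add_left_mono nn_integral_dt_over_t_min)
  finally show ?thesis .
qed

section \<open>Dyadic Hardy inequalities\<close>

text \<open>Half of the geometric weight is spent on summability, the other half is kept: every
  \<open>\<sigma>\<^bsup>k+1\<^esup> g k\<close> is at most the \<open>b\<close>-th root of the last series, which replaces Jensen's inequality.\<close>

lemma suminf_powr_le:
  fixes \<sigma> b :: real and g :: "nat \<Rightarrow> real"
  assumes s: "0 < \<sigma>" "\<sigma> < 1" and b: "1 \<le> b" and g: "\<And>k. 0 \<le> g k" "\<And>k. g k \<le> 1"
  shows "(\<Sum>k. \<sigma> ^ (2 * Suc k) * g k) powr b
    \<le> (\<Sum>k. \<sigma> ^ Suc k) powr b * (\<Sum>k. \<sigma> ^ Suc k * g k powr b)"
    and "summable (\<lambda>k. \<sigma> ^ (2 * Suc k) * g k)"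
    and "summable (\<lambda>k. \<sigma> ^ Suc k * g k powr b)"
    and "summable (\<lambda>k. \<sigma> ^ Suc k)"
    and "(\<Sum>k. \<sigma> ^ (2 * Suc k) * g k) \<le> (\<Sum>k. \<sigma> ^ Suc k)"
proof -
  show sW: "summable (\<lambda>k. \<sigma> ^ Suc k)" using s by (simp add: summable_geometric)
  have gb: "g k powr b \<le> 1" for k using g b by (intro powr_le1) auto
  show sS: "summable (\<lambda>k. \<sigma> ^ Suc k * g k powr b)"
  proof (rule summable_comparison_test'[OF sW])
    show "norm (\<sigma> ^ Suc k * g k powr b) \<le> \<sigma> ^ Suc k" for k
      using gb[of k] s mult_left_mono[OF gb[of k], of "\<sigma> ^ Suc k"] by (simp add: abs_mult)
  qed
  define S where "S = (\<Sum>k. \<sigma> ^ Suc k * g k powr b)"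
  have S0: "0 \<le> S" unfolding S_def using s by (intro suminf_nonneg sS) auto
  have sg: "\<sigma> ^ Suc k * g k \<le> S powr (1 / b)" for k
  proof -
    have s1: "0 < \<sigma> ^ Suc k" "\<sigma> ^ Suc k \<le> 1" using s by (simp, intro power_le_one) auto
    have "(\<sigma> ^ Suc k * g k) powr b = (\<sigma> ^ Suc k) powr b * g k powr b"
      using g s1 by (intro powr_mult)
    also have "\<dots> \<le> (\<sigma> ^ Suc k) powr 1 * g k powr b"
      using s1 b by (intro mult_right_mono powr_mono') auto
    also have "\<dots> = \<sigma> ^ Suc k * g k powr b" using s1 by simp
    also have "\<dots> \<le> S" unfolding S_def
      using sum_le_suminf[OF sS, of "{k}"] s by auto
    finally have "((\<sigma> ^ Suc k * g k) powr b) powr (1 / b) \<le> S powr (1 / b)"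
      using b by (intro powr_mono2) auto
    then show ?thesis using b g s1 by (simp add: powr_powr)
  qed
  have le_S: "\<sigma> ^ (2 * Suc k) * g k \<le> \<sigma> ^ Suc k * S powr (1 / b)" for k
  proof -
    have "\<sigma> ^ (2 * Suc k) * g k = \<sigma> ^ Suc k * (\<sigma> ^ Suc k * g k)"
      by (simp add: mult_2 power_add)
    also have "\<dots> \<le> \<sigma> ^ Suc k * S powr (1 / b)"
      using sg[of k] s by (intro mult_left_mono) auto
    finally show ?thesis .
  qed
  have le_W: "\<sigma> ^ (2 * Suc k) * g k \<le> \<sigma> ^ Suc k" for k
  proof -
    have "\<sigma> ^ (2 * Suc k) * g k \<le> \<sigma> ^ Suc k * 1"
      using g s by (intro mult_mono power_decreasing) auto
    then show ?thesis by simp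
  qed
  have nonneg: "0 \<le> \<sigma> ^ (2 * Suc k) * g k" for k using g s by auto
  show sH: "summable (\<lambda>k. \<sigma> ^ (2 * Suc k) * g k)"
    by (rule summable_comparison_test'[OF sW]) (use le_W nonneg in \<open>simp only: real_norm_def abs_of_nonneg\<close>)
  show "(\<Sum>k. \<sigma> ^ (2 * Suc k) * g k) \<le> (\<Sum>k. \<sigma> ^ Suc k)"
    by (rule suminf_le[OF le_W sH sW])
  have "(\<Sum>k. \<sigma> ^ (2 * Suc k) * g k) \<le> (\<Sum>k. \<sigma> ^ Suc k * S powr (1 / b))"
    by (intro suminf_le le_S sH summable_mult2 sW)
  also have "\<dots> = (\<Sum>k. \<sigma> ^ Suc k) * S powr (1 / b)"
    by (rule suminf_mult2[OF sW, symmetric])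
  finally have "(\<Sum>k. \<sigma> ^ (2 * Suc k) * g k) powr b \<le> ((\<Sum>k. \<sigma> ^ Suc k) * S powr (1 / b)) powr b"
    using b nonneg by (intro powr_mono2 suminf_nonneg sH) auto
  also have "\<dots> = (\<Sum>k. \<sigma> ^ Suc k) powr b * S"
    using b S0 s sW by (subst powr_mult) (auto simp: powr_powr intro!: suminf_nonneg)
  finally show "(\<Sum>k. \<sigma> ^ (2 * Suc k) * g k) powr b
    \<le> (\<Sum>k. \<sigma> ^ Suc k) powr b * (\<Sum>k. \<sigma> ^ Suc k * g k powr b)" unfolding S_def .
qed

text \<open>The pointwise bound \<open>suminf_powr_le\<close> is integrated term by term. Every
  dilate of \<open>G\<close> has the same integral with respect to \<open>dt/t\<close>, so only the
  geometric series remains.\<close>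

lemma hardy_modular_const:
  fixes \<sigma> b :: real and G :: "real \<Rightarrow> real"
  assumes s: "0 < \<sigma>" "\<sigma> < 1" and b: "1 \<le> b"
    and G[measurable]: "G \<in> borel_measurable borel"
    and G01: "\<And>t. 0 < t \<Longrightarrow> 0 \<le> G t" "\<And>t. 0 < t \<Longrightarrow> G t \<le> 1"
  shows "(\<integral>\<^sup>+ t. ennreal ((\<Sum>k. \<sigma> ^ (2 * Suc k) * G (t / 2 ^ Suc k)) powr b) \<partial>dt_over_t_measure)
    \<le> ennreal ((\<Sum>k. \<sigma> ^ Suc k) powr b * (\<Sum>k. \<sigma> ^ Suc k)) * (\<integral>\<^sup>+ t. ennreal (G t powr b) \<partial>dt_over_t_measure)"
proof -
  define W where "W = (\<Sum>k. \<sigma> ^ Suc k)"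
  have sW: "summable (\<lambda>k. \<sigma> ^ Suc k)" using s by (simp add: summable_geometric)
  have meas: "(\<lambda>t. ennreal (G (t / 2 ^ Suc k) powr b)) \<in> borel_measurable dt_over_t_measure" for k
    by (intro borel_measurable_dt_over_t measurable_completion) measurable
  have "(\<integral>\<^sup>+ t. ennreal ((\<Sum>k. \<sigma> ^ (2 * Suc k) * G (t / 2 ^ Suc k)) powr b) \<partial>dt_over_t_measure)
    \<le> (\<integral>\<^sup>+ t. ennreal (W powr b) * (\<Sum>k. ennreal (\<sigma> ^ Suc k) * ennreal (G (t / 2 ^ Suc k) powr b)) \<partial>dt_over_t_measure)"
  proof (intro nn_integral_mono)
    fix t assume "t \<in> space dt_over_t_measure"
    then have "0 < t / 2 ^ Suc k" for k by (simp add: space_dt_over_t)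
    note * = suminf_powr_le[where g = "\<lambda>k. G (t / 2 ^ Suc k)", OF s b G01(1)[OF this] G01(2)[OF this]]
    have "(\<Sum>k. ennreal (\<sigma> ^ Suc k) * ennreal (G (t / 2 ^ Suc k) powr b))
        = ennreal (\<Sum>k. \<sigma> ^ Suc k * G (t / 2 ^ Suc k) powr b)"
      using s by (subst suminf_ennreal2[symmetric, OF _ *(3)]) (simp_all add: ennreal_mult'')
    moreover have "ennreal ((\<Sum>k. \<sigma> ^ (2 * Suc k) * G (t / 2 ^ Suc k)) powr b)
      \<le> ennreal (W powr b) * ennreal (\<Sum>k. \<sigma> ^ Suc k * G (t / 2 ^ Suc k) powr b)"
      using ennreal_leI[OF *(1)] by (simp add: W_def ennreal_mult')
    ultimately show "ennreal ((\<Sum>k. \<sigma> ^ (2 * Suc k) * G (t / 2 ^ Suc k)) powr b)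
      \<le> ennreal (W powr b) * (\<Sum>k. ennreal (\<sigma> ^ Suc k) * ennreal (G (t / 2 ^ Suc k) powr b))"
      by simp
  qed
  also have "\<dots> = ennreal (W powr b) * (\<Sum>k. ennreal (\<sigma> ^ Suc k) *
      (\<integral>\<^sup>+ t. ennreal (G (t / 2 ^ Suc k) powr b) \<partial>dt_over_t_measure))"
  proof -
    have m: "(\<lambda>t. ennreal (\<sigma> ^ Suc k) * ennreal (G (t / 2 ^ Suc k) powr b)) \<in> borel_measurable dt_over_t_measure" for k
      by (intro borel_measurable_times_ennreal borel_measurable_const meas)
    show ?thesis
      by (subst nn_integral_cmult, intro borel_measurable_suminf_order m,
          subst nn_integral_suminf, rule m, subst nn_integral_cmult, rule meas, rule refl)
  qed
  also have "\<dots> = ennreal (W powr b) * (\<Sum>k. ennreal (\<sigma> ^ Suc k) *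
      (\<integral>\<^sup>+ t. ennreal (G t powr b) \<partial>dt_over_t_measure))"
  proof -
    have "(\<integral>\<^sup>+ t. ennreal (G (t / 2 ^ Suc k) powr b) \<partial>dt_over_t_measure) =
        (\<integral>\<^sup>+ t. ennreal (G t powr b) \<partial>dt_over_t_measure)" for k
      by (rule nn_integral_dt_over_t_dilation[where h = "\<lambda>t. ennreal (G t powr b)"]) auto
    then show ?thesis by simp
  qed
  also have "\<dots> = ennreal (W powr b) * (ennreal W * (\<integral>\<^sup>+ t. ennreal (G t powr b) \<partial>dt_over_t_measure))"
    unfolding W_def using s by (subst suminf_ennreal2[OF _ sW, symmetric]) auto
  finally show ?thesis by (simp add: W_def ennreal_mult' mult.assoc)
qed

text \<open>The modular is moved from \<open>q\<close> to \<open>qinf\<close>, estimated there by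
  the constant-exponent case, and moved back. A change of exponent requires values in
  \<open>[0, 1]\<close>, so the weighted sum is first divided by the total weight \<open>W\<close>.
  The constant is uniform in \<open>G\<close>.\<close>

lemma hardy_modular:
  fixes \<sigma> c qinf :: real and q :: "real \<Rightarrow> real"
  assumes s: "0 < \<sigma>" "\<sigma> < 1" and q[measurable]: "q \<in> borel_measurable lebesgue"
    and q1: "\<And>t. 1 \<le> q t" and qinf: "1 \<le> qinf"
    and c: "\<forall>t>0. \<bar>q t - qinf\<bar> * \<bar>ln t\<bar> \<le> c"
  shows "\<exists>C>0. \<forall>G. G \<in> borel_measurable borel \<longrightarrow> (\<forall>t>0. 0 \<le> G t \<and> G t \<le> 1) \<longrightarrow>
    (\<integral>\<^sup>+ t. ennreal (G t powr q t) \<partial>dt_over_t_measure) \<le> 1 \<longrightarrow>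
    (\<integral>\<^sup>+ t. ennreal (((\<Sum>k. \<sigma> ^ (2 * Suc k) * G (t / 2 ^ Suc k)) / C) powr q t) \<partial>dt_over_t_measure) \<le> 1"
proof -
  define W where "W = (\<Sum>k. \<sigma> ^ Suc k)"
  have sW: "summable (\<lambda>k. \<sigma> ^ Suc k)" using s by (simp add: summable_geometric)
  have W: "W > 0" unfolding W_def by (rule suminf_pos[OF sW]) (use s in simp)
  \<comment> \<open>Bound for the \<open>q\<close>-modular of \<open>H / W\<close>: passing to
    \<open>qinf\<close> gives \<open>exp c + 2\<close>, the Hardy inequality contributes the factor
    \<open>W\<close>, and the return to \<open>q\<close> costs a factor \<open>exp c\<close> and a
    summand 2.\<close>
  define D where "D = exp c * (W * (exp c + 2)) + 2"
  have D: "D \<ge> 1" unfolding D_def using W by (smt (verit) exp_gt_zero mult_pos_pos)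
  show ?thesis
  proof (intro exI[of _ "W * D"] conjI allI impI)
    show "W * D > 0" using W D by simp
    fix G :: "real \<Rightarrow> real"
    assume G[measurable]: "G \<in> borel_measurable borel" and G01: "\<forall>t>0. 0 \<le> G t \<and> G t \<le> 1"
      and mod: "(\<integral>\<^sup>+ t. ennreal (G t powr q t) \<partial>dt_over_t_measure) \<le> 1"
    define H where "H t = (\<Sum>k. \<sigma> ^ (2 * Suc k) * G (t / 2 ^ Suc k))" for t
    have [measurable]: "H \<in> borel_measurable borel" unfolding H_def by measurable
    have H0: "0 \<le> H t" "H t \<le> W" if "t > 0" for t
    proof -
      have "0 < t / 2 ^ Suc k" for k using that by simp
      then have g: "0 \<le> G (t / 2 ^ Suc k)" "G (t / 2 ^ Suc k) \<le> 1" for k using G01 by blast+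
      note * = suminf_powr_le[where g = "\<lambda>k. G (t / 2 ^ Suc k)" and b = 1, OF s _ g]
      show "0 \<le> H t" unfolding H_def using s g by (intro suminf_nonneg *(2)) auto
      show "H t \<le> W" unfolding H_def W_def using *(5) by simp
    qed
    have [measurable]: "G \<in> borel_measurable lebesgue" by (intro measurable_completion) simp
    have Hl[measurable]: "H \<in> borel_measurable lebesgue" by (intro measurable_completion) simp
    have "(\<integral>\<^sup>+ t. ennreal (G t powr qinf) \<partial>dt_over_t_measure)
        \<le> ennreal (exp c) * (\<integral>\<^sup>+ t. ennreal (G t powr q t) \<partial>dt_over_t_measure) + 2"
      using G01 c qinf by (intro modular_exponent_change) (auto simp: abs_minus_commute)
    also have "\<dots> \<le> ennreal (exp c) * 1 + 2" by (intro add_right_mono mult_left_mono mod) simp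
    finally have Gi: "(\<integral>\<^sup>+ t. ennreal (G t powr qinf) \<partial>dt_over_t_measure) \<le> ennreal (exp c + 2)" by simp
    have hm: "(\<lambda>t. ennreal (H t powr qinf)) \<in> borel_measurable dt_over_t_measure"
      by (intro borel_measurable_dt_over_t) measurable
    have "(\<integral>\<^sup>+ t. ennreal ((H t / W) powr qinf) \<partial>dt_over_t_measure) =
       (\<integral>\<^sup>+ t. ennreal (1 / W powr qinf) * ennreal (H t powr qinf) \<partial>dt_over_t_measure)"
      using W H0 by (intro nn_integral_cong) (simp add: space_dt_over_t powr_divide ennreal_mult'[symmetric])
    also have "\<dots> = ennreal (1 / W powr qinf) * (\<integral>\<^sup>+ t. ennreal (H t powr qinf) \<partial>dt_over_t_measure)"
      by (rule nn_integral_cmult[OF hm])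
    also have "\<dots> \<le> ennreal (1 / W powr qinf) * (ennreal (W powr qinf * W) * ennreal (exp c + 2))"
      using hardy_modular_const[OF s qinf G] G01 unfolding H_def W_def
      by (intro mult_left_mono order_trans[OF _ mult_left_mono[OF Gi]]) auto
    also have "\<dots> = ennreal (W * (exp c + 2))"
      using W by (simp add: ennreal_mult'[symmetric] ennreal_mult''[symmetric] del: ennreal_plus)
    finally have Hi: "(\<integral>\<^sup>+ t. ennreal ((H t / W) powr qinf) \<partial>dt_over_t_measure) \<le> ennreal (W * (exp c + 2))" .
    have "(\<integral>\<^sup>+ t. ennreal ((H t / W) powr q t) \<partial>dt_over_t_measure)
      \<le> ennreal (exp c) * (\<integral>\<^sup>+ t. ennreal ((H t / W) powr qinf) \<partial>dt_over_t_measure) + 2"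
      using H0 W q1 c by (intro modular_exponent_change) auto
    also have "\<dots> \<le> ennreal (exp c) * ennreal (W * (exp c + 2)) + 2"
      by (intro add_right_mono mult_left_mono Hi) simp
    also have "\<dots> = ennreal D"
    proof -
      have "ennreal D = ennreal (exp c * (W * (exp c + 2))) + ennreal 2"
        unfolding D_def using W by (intro ennreal_plus) auto
      then show ?thesis by (simp add: ennreal_mult' del: ennreal_plus)
    qed
    finally have HD: "(\<integral>\<^sup>+ t. ennreal ((H t / W) powr q t) \<partial>dt_over_t_measure) \<le> ennreal D" .
    have hm2: "(\<lambda>t. ennreal ((H t / W) powr q t)) \<in> borel_measurable dt_over_t_measure"
      by (intro borel_measurable_dt_over_t) measurable
    have "(\<integral>\<^sup>+ t. ennreal ((H t / (W * D)) powr q t) \<partial>dt_over_t_measure)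
      \<le> (\<integral>\<^sup>+ t. ennreal (1 / D) * ennreal ((H t / W) powr q t) \<partial>dt_over_t_measure)"
    proof (intro nn_integral_mono)
      fix t assume "t \<in> space dt_over_t_measure"
      then have t: "t > 0" by (simp add: space_dt_over_t)
      have "(H t / (W * D)) powr q t = (1 / D) powr q t * (H t / W) powr q t"
        using H0[OF t] W D by (subst powr_mult[symmetric]) (auto simp: mult.commute)
      \<comment> \<open>Since \<open>D \<ge> 1\<close> and \<open>q t \<ge> 1\<close>, dividing the
        function by \<open>D\<close> divides the modular by at least \<open>D\<close>.\<close>
      also have "\<dots> \<le> (1 / D) powr 1 * (H t / W) powr q t"
        using D q1 by (intro mult_right_mono powr_mono') auto
      finally show "ennreal ((H t / (W * D)) powr q t) \<le> ennreal (1 / D) * ennreal ((H t / W) powr q t)"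
        using D by (simp add: ennreal_mult'[symmetric] ennreal_leI)
    qed
    also have "\<dots> = ennreal (1 / D) * (\<integral>\<^sup>+ t. ennreal ((H t / W) powr q t) \<partial>dt_over_t_measure)"
      by (rule nn_integral_cmult[OF hm2])
    also have "\<dots> \<le> ennreal (1 / D) * ennreal D" by (intro mult_left_mono HD) simp
    also have "\<dots> = 1" using D by (simp add: ennreal_mult'[symmetric])
    finally show "(\<integral>\<^sup>+ t. ennreal (((\<Sum>k. \<sigma> ^ (2 * Suc k) * G (t / 2 ^ Suc k)) / (W * D)) powr q t)
        \<partial>dt_over_t_measure) \<le> 1" unfolding H_def .
  qed
qed

subsection \<open>Rearrangements and the K-functional\<close>

lemma rearrangement_antimono:
  assumes "u \<le> t"
  shows "rearrangement f t \<le> rearrangement f u"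
  unfolding rearrangement_def
  using assms by (intro Sup_subset_mono) (auto intro: le_less_trans[OF ennreal_leI])

lemma borel_measurable_antimono_ennreal:
  fixes f :: "real \<Rightarrow> ennreal"
  assumes "\<And>u t. u \<le> t \<Longrightarrow> f t \<le> f u"
  shows "f \<in> borel_measurable borel"
proof (rule borel_measurableI_greater)
  fix y
  have "is_interval {x. y < f x}"
    unfolding is_interval_1 using assms by (auto intro: less_le_trans)
  then show "{x \<in> space borel. y < f x} \<in> sets borel"
    by (simp add: real_interval_borel_measurable)
qed

lemma borel_measurable_rearrangement [measurable]: "rearrangement f \<in> borel_measurable borel"
  by (intro borel_measurable_antimono_ennreal rearrangement_antimono)

text \<open>Let \<open>b\<close> be the essential bound of \<open>f1\<close>. Where
  \<open>norm (f0 + f1)\<close> exceeds a level \<open>r > b\<close>, \<open>norm (f0 x)\<close>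
  exceeds \<open>r - b\<close> almost everywhere. Markov's inequality then bounds
  \<open>t * (r - b)\<close> by the integral of \<open>norm (f0 x)\<close> whenever that level set
  has measure above \<open>t\<close>.\<close>

lemma rearrangement_le_K_functional:
  fixes f :: "real ^ 'n \<Rightarrow> 'b::{banach, second_countable_topology}"
  assumes t: "0 < t"
  shows "ennreal t * rearrangement f t \<le> K_functional L1_space Linf_space t f"
  unfolding K_functional_def
proof (rule Inf_greatest, clarify)
  fix f0 f1 :: "real ^ 'n \<Rightarrow> 'b"
  assume "f0 \<in> carr L1_space" "f1 \<in> carr Linf_space"
  then have int: "integrable lebesgue f0" and [measurable]: "f1 \<in> borel_measurable lebesgue"
    and fin: "esssup lebesgue (\<lambda>x. ennreal (norm (f1 x))) < \<infinity>"
    by (auto simp: L1_space_def Linf_space_def Let_def)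
  from int have [measurable]: "f0 \<in> borel_measurable lebesgue" by auto
  define b where "b = enn2real (esssup lebesgue (\<lambda>x. ennreal (norm (f1 x))))"
  have b: "esssup lebesgue (\<lambda>x. ennreal (norm (f1 x))) = ennreal b" "0 \<le> b"
    using fin by (auto simp: b_def)
  define I where "I = (\<integral>\<^sup>+ x. ennreal (norm (f0 x)) \<partial>lebesgue)"
  have AE: "AE x in lebesgue. norm (f1 x) \<le> b"
    using esssup_AE[of "\<lambda>x. ennreal (norm (f1 x))" lebesgue] b by (auto simp: ennreal_le_iff)
  have "ennreal t * ennreal r \<le> I + ennreal t * ennreal b"
    if r: "0 < r" "ennreal t < distribution_fun (f0 + f1) r" for r
  proof (cases "r \<le> b")
    case True
    then have "ennreal t * ennreal r \<le> ennreal t * ennreal b"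
      by (intro mult_left_mono ennreal_leI) auto
    then show ?thesis by (simp add: add_increasing)
  next
    case False
    have meas: "{x \<in> space lebesgue. 1 \<le> ennreal (1 / (r - b)) * ennreal (norm (f0 x))} \<in> sets lebesgue"
      by measurable
    have "ennreal t \<le> emeasure lebesgue {x. norm ((f0 + f1) x) > r}"
      using r by (simp add: distribution_fun_def)
    also have "\<dots> \<le> emeasure lebesgue {x \<in> UNIV. 1 \<le> ennreal (1 / (r - b)) * ennreal (norm (f0 x))}"
    proof (rule emeasure_mono_AE)
      show "AE x in lebesgue. x \<in> {x. norm ((f0 + f1) x) > r} \<longrightarrow>
          x \<in> {x \<in> UNIV. 1 \<le> ennreal (1 / (r - b)) * ennreal (norm (f0 x))}"
        using AE
      proof eventually_elim
        case (elim x)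
        show ?case
        proof
          assume "x \<in> {x. norm ((f0 + f1) x) > r}"
          then have "r < norm (f0 x) + norm (f1 x)"
            using norm_triangle_ineq[of "f0 x" "f1 x"] by simp
          then have "1 \<le> 1 / (r - b) * norm (f0 x)" using elim False by (simp add: field_simps)
          then show "x \<in> {x \<in> UNIV. 1 \<le> ennreal (1 / (r - b)) * ennreal (norm (f0 x))}"
            using False by (simp add: ennreal_mult'[symmetric] ennreal_leI flip: ennreal_1)
        qed
      qed
    qed (use meas in simp)
    also have "\<dots> \<le> ennreal (1 / (r - b)) * (\<integral>\<^sup>+ x. ennreal (norm (f0 x)) * indicator UNIV x \<partial>lebesgue)"
      by (rule nn_integral_Markov_inequality) auto
    finally have "ennreal t \<le> ennreal (1 / (r - b)) * I" by (simp add: I_def)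
    then have "ennreal (r - b) * ennreal t \<le> ennreal (r - b) * (ennreal (1 / (r - b)) * I)"
      by (intro mult_left_mono) auto
    also have "\<dots> = I" using False by (simp add: mult.assoc[symmetric] ennreal_mult'[symmetric])
    finally have "ennreal (r - b) * ennreal t + ennreal t * ennreal b \<le> I + ennreal t * ennreal b"
      by (intro add_right_mono)
    moreover have "ennreal (r - b) * ennreal t + ennreal t * ennreal b = ennreal t * ennreal r"
    proof -
      have "ennreal r = ennreal (r - b) + ennreal b"
        using False b by (subst ennreal_plus[symmetric]) auto
      then show ?thesis by (simp add: algebra_simps del: ennreal_plus)
    qed
    ultimately show ?thesis by simp
  qed
  \<comment> \<open>The factor \<open>t\<close> moves inside the supremum defining the
    rearrangement, so the bound for each admissible level \<open>r\<close> suffices.\<close>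
  then show "ennreal t * rearrangement (f0 + f1) t \<le> nrm L1_space f0 + ennreal t * nrm Linf_space f1"
    unfolding rearrangement_def SUP_mult_left_ennreal[of _ "\<lambda>x. x", simplified]
    by (intro SUP_least) (auto simp: L1_space_def Linf_space_def Let_def I_def b)
qed

text \<open>A level strictly above \<open>r\<close> cannot be admissible in the supremum, so its
  level set has measure at most \<open>t\<close>. The level \<open>r\<close> itself is reached by
  continuity from below along \<open>r + 1 / real (Suc n)\<close>.\<close>

lemma distribution_fun_rearrangement_le:
  fixes f :: "real ^ 'n \<Rightarrow> 'b::{real_normed_vector, second_countable_topology}"
  assumes [measurable]: "f \<in> borel_measurable lebesgue"
    and r: "rearrangement f t \<le> ennreal r" "0 \<le> r"
  shows "emeasure lebesgue {x. norm (f x) > r} \<le> ennreal t"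
proof -
  define A where "A n = {x. norm (f x) > r + 1 / real (Suc n)}" for n
  have A[measurable]: "A n \<in> sets lebesgue" for n
  proof -
    have "{x \<in> space lebesgue. norm (f x) > r + 1 / real (Suc n)} \<in> sets lebesgue" by measurable
    then show ?thesis by (simp add: A_def)
  qed
  have "{x. norm (f x) > r} = (\<Union>n. A n)"
  proof (intro set_eqI iffI)
    fix x assume "x \<in> {x. norm (f x) > r}"
    then obtain n where "inverse (real (Suc n)) < norm (f x) - r"
      using reals_Archimedean[of "norm (f x) - r"] by auto
    then show "x \<in> (\<Union>n. A n)" by (auto simp: A_def inverse_eq_divide intro!: exI[of _ n])
  next
    fix x assume "x \<in> (\<Union>n. A n)"
    then obtain n where "norm (f x) > r + 1 / real (Suc n)" by (auto simp: A_def)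
    then show "x \<in> {x. norm (f x) > r}" by (smt (verit) mem_Collect_eq divide_nonneg_nonneg of_nat_0_le_iff)
  qed
  also have "emeasure lebesgue \<dots> = (SUP n. emeasure lebesgue (A n))"
  proof (rule SUP_emeasure_incseq[symmetric])
    show "incseq A"
    proof (rule incseq_SucI)
      fix n show "A n \<le> A (Suc n)"
      proof
        fix x assume "x \<in> A n"
        moreover have "1 / real (Suc (Suc n)) \<le> 1 / real (Suc n)" by (intro divide_left_mono) auto
        ultimately show "x \<in> A (Suc n)" by (simp add: A_def)
      qed
    qed
  qed (use A in auto)
  also have "\<dots> \<le> ennreal t"
  proof (rule SUP_least, rule ccontr)
    fix n assume "\<not> emeasure lebesgue (A n) \<le> ennreal t"
    then have "ennreal t < distribution_fun f (r + 1 / real (Suc n))"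
      by (simp add: distribution_fun_def A_def)
    then have "ennreal (r + 1 / real (Suc n)) \<le> rearrangement f t"
      unfolding rearrangement_def using r
      by (intro Sup_upper) (auto intro!: exI[of _ "r + 1 / real (Suc n)"] add_nonneg_pos)
    also have "\<dots> \<le> ennreal r" by fact
    finally have "r + 1 / real (Suc n) \<le> r" using r by (simp add: ennreal_le_iff)
    then show False by (smt (verit) divide_pos_pos of_nat_0_less_iff zero_less_Suc)
  qed
  finally show ?thesis .
qed

lemma le_suminf_ennreal:
  fixes f :: "nat \<Rightarrow> ennreal"
  shows "f k \<le> suminf f"
  using sum_le_suminf[of f "{k}"] by simp

text \<open>Split \<open>f\<close> at height \<open>f\<^sup>*(t)\<close> and slice the upper part at the heights \<open>f\<^sup>*(t/2\<^sup>k)\<close>; the set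
  where \<open>f\<close> exceeds height number \<open>k\<close> has measure at most \<open>t/2\<^sup>k\<close>.\<close>

lemma K_functional_le_rearrangement:
  fixes f :: "real ^ 'n \<Rightarrow> 'b::{banach, second_countable_topology}"
  assumes f[measurable]: "f \<in> borel_measurable lebesgue"
    and fin: "\<And>u. 0 < u \<Longrightarrow> rearrangement f u < \<infinity>" and t: "0 < t"
    and S: "(\<Sum>k. ennreal (t / 2 ^ k) * rearrangement f (t / 2 ^ Suc k)) < \<infinity>"
  shows "K_functional L1_space Linf_space t f
    \<le> 2 * (\<Sum>k. ennreal (t / 2 ^ k) * rearrangement f (t / 2 ^ Suc k))"
    and "f \<in> sum_carrier L1_space Linf_space"
proof -
  let ?S = "\<Sum>k. ennreal (t / 2 ^ k) * rearrangement f (t / 2 ^ Suc k)"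
  define r where "r k = enn2real (rearrangement f (t / 2 ^ k))" for k :: nat
  have r: "rearrangement f (t / 2 ^ k) = ennreal (r k)" "0 \<le> r k" for k
    using fin[of "t / 2 ^ k"] t by (auto simp: r_def)
  define f0 where "f0 = (\<lambda>x. if norm (f x) \<le> r 0 then 0 else f x)"
  define f1 where "f1 = (\<lambda>x. if norm (f x) \<le> r 0 then f x else 0)"
  have [measurable]: "f0 \<in> borel_measurable lebesgue" unfolding f0_def by measurable
  have [measurable]: "f1 \<in> borel_measurable lebesgue" unfolding f1_def by measurable
  have f: "f = f0 + f1" by (auto simp: f0_def f1_def)
  have f1_le: "esssup lebesgue (\<lambda>x. ennreal (norm (f1 x))) \<le> ennreal (r 0)"
    by (rule esssup_I) (auto simp: f1_def r intro!: ennreal_leI)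
  define E where "E k = {x. norm (f x) > r k}" for k
  have E[measurable]: "E k \<in> sets lebesgue" for k
  proof -
    have "{x \<in> space lebesgue. norm (f x) > r k} \<in> sets lebesgue" by measurable
    then show ?thesis by (simp add: E_def)
  qed
  have Ek: "emeasure lebesgue (E k) \<le> ennreal (t / 2 ^ k)" for k
    unfolding E_def by (rule distribution_fun_rearrangement_le[OF assms(1)]) (auto simp: r)
  \<comment> \<open>The measures of the \<open>E k\<close> tend to 0, so almost every point lies at
    or below some height \<open>r j\<close>; the slices thus cover the support of \<open>f0\<close>
    up to a null set.\<close>
  have "emeasure lebesgue (\<Inter>k. E k) \<le> ennreal (t / 2 ^ k)" for k
    by (rule order_trans[OF emeasure_mono Ek[of k]]) auto
  moreover have "(\<lambda>k. ennreal (t / 2 ^ k)) \<longlonglongrightarrow> ennreal 0"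
  proof (rule tendsto_ennrealI)
    have "(\<lambda>k. t * (1 / 2) ^ k) \<longlonglongrightarrow> t * 0"
      by (intro tendsto_mult tendsto_const LIMSEQ_power_zero) auto
    then show "(\<lambda>k. t / 2 ^ k) \<longlonglongrightarrow> 0" by (simp add: power_divide)
  qed
  ultimately have "emeasure lebesgue (\<Inter>k. E k) \<le> ennreal 0"
    by (intro LIMSEQ_le_const) auto
  then have null: "(\<Inter>k. E k) \<in> null_sets lebesgue" by auto
  have AE0: "AE x in lebesgue. x \<notin> (\<Inter>k. E k)" using null by (rule AE_not_in)
  have "(\<integral>\<^sup>+ x. ennreal (norm (f0 x)) \<partial>lebesgue)
    \<le> (\<integral>\<^sup>+ x. (\<Sum>k. ennreal (r (Suc k)) * indicator (E k) x) \<partial>lebesgue)"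
  proof (rule nn_integral_mono_AE)
    show "AE x in lebesgue. ennreal (norm (f0 x)) \<le> (\<Sum>k. ennreal (r (Suc k)) * indicator (E k) x)"
      using AE0
    proof eventually_elim
      case (elim x)
      show ?case
      proof (cases "norm (f x) \<le> r 0")
        case True
        then show ?thesis by (simp add: f0_def)
      next
        case False
        from elim obtain j where "norm (f x) \<le> r j" by (auto simp: E_def not_less)
        \<comment> \<open>As \<open>norm (f x)\<close> is above \<open>r 0\<close> but not above
          \<open>r j\<close>, there is an index where it passes from above \<open>r k\<close> to at
          most \<open>r (Suc k)\<close>. The term of that index alone dominates
          \<open>norm (f0 x)\<close>.\<close>
        then have "\<exists>k. \<not> norm (f x) \<le> r k \<and> norm (f x) \<le> r (Suc k)"
        proof (induction j)
          case 0
          then show ?case using False by simp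
        qed blast
        then obtain k where k: "\<not> norm (f x) \<le> r k" "norm (f x) \<le> r (Suc k)" by blast
        have "ennreal (norm (f0 x)) \<le> ennreal (r (Suc k)) * indicator (E k) x"
          using k False by (simp add: f0_def E_def ennreal_leI)
        also have "\<dots> \<le> (\<Sum>k. ennreal (r (Suc k)) * indicator (E k) x)"
          by (rule le_suminf_ennreal)
        finally show ?thesis .
      qed
    qed
  qed
  also have "\<dots> = (\<Sum>k. ennreal (r (Suc k)) * emeasure lebesgue (E k))"
    by (simp add: nn_integral_suminf nn_integral_cmult_indicator)
  also have "\<dots> \<le> ?S"
  proof (rule suminf_le[OF _ summableI summableI])
    fix k
    have "emeasure lebesgue (E k) * ennreal (r (Suc k)) \<le> ennreal (t / 2 ^ k) * ennreal (r (Suc k))"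
      by (rule mult_right_mono[OF Ek]) (rule zero_le)
    then show "ennreal (r (Suc k)) * emeasure lebesgue (E k)
        \<le> ennreal (t / 2 ^ k) * rearrangement f (t / 2 ^ Suc k)"
      by (simp only: r(1) mult.commute)
  qed
  finally have f0_le: "(\<integral>\<^sup>+ x. ennreal (norm (f0 x)) \<partial>lebesgue) \<le> ?S" .
  have f0: "f0 \<in> carr L1_space"
    using le_less_trans[OF f0_le S] by (simp add: L1_space_def integrable_iff_bounded)
  have f1: "f1 \<in> carr Linf_space"
    using le_less_trans[OF f1_le ennreal_less_top] by (simp add: Linf_space_def Let_def)
  show "f \<in> sum_carrier L1_space Linf_space"
    unfolding sum_carrier_def by (intro CollectI exI conjI) (rule f, rule f0, rule f1)
  \<comment> \<open>The bounded part \<open>f1\<close> contributes at most \<open>t\<close> times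
    the rearrangement at \<open>t\<close>, which monotonicity bounds by the term of index 0. Hence
    the factor 2 in the result.\<close>
  have "ennreal t * rearrangement f t \<le> ennreal t * rearrangement f (t / 2)"
    using t by (intro mult_left_mono rearrangement_antimono) auto
  also have "\<dots> \<le> ?S"
    using le_suminf_ennreal[of "\<lambda>k. ennreal (t / 2 ^ k) * rearrangement f (t / 2 ^ Suc k)" 0] by simp
  finally have tf: "ennreal t * ennreal (r 0) \<le> ?S" using r[of 0] by simp
  have "K_functional L1_space Linf_space t f \<le> nrm L1_space f0 + ennreal t * nrm Linf_space f1"
    unfolding K_functional_def
    by (intro Inf_lower CollectI exI conjI) (rule refl, rule f0, rule f1, rule f)
  also have "\<dots> \<le> ?S + ennreal t * ennreal (r 0)"
    by (simp only: L1_space_def Linf_space_def Let_def fst_conv snd_conv)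
       (intro add_mono mult_left_mono f0_le f1_le zero_le)
  also have "\<dots> \<le> ?S + ?S" by (rule add_left_mono[OF tf])
  finally show "K_functional L1_space Linf_space t f \<le> 2 * ?S" by (simp only: mult_2)
qed

subsection \<open>Luxemburg norms\<close>

lemma ennpowr_mono: "x \<le> y \<Longrightarrow> 0 \<le> a \<Longrightarrow> ennpowr x a \<le> ennpowr y a"
  unfolding ennpowr_def
  by (auto simp: top_unique infinity_ennreal_def intro!: ennreal_leI powr_mono2 enn2real_mono simp: less_top[symmetric])

lemma ennpowr_ennreal: "0 \<le> x \<Longrightarrow> ennpowr (ennreal x) a = ennreal (x powr a)"
  by (simp add: ennpowr_def)

lemma ennpowr_cmult:
  assumes "0 < c"
  shows "ennpowr (ennreal c * x) a = ennreal (c powr a) * ennpowr x a"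
proof (cases x)
  case (real r)
  then show ?thesis using assms
    by (simp add: ennreal_mult'[symmetric] ennpowr_ennreal powr_mult)
next
  case top
  then show ?thesis using assms by (simp add: ennpowr_def ennreal_mult_top)
qed

lemma borel_measurable_ennpowr [measurable]:
  assumes [measurable]: "g \<in> borel_measurable M" "q \<in> borel_measurable M"
  shows "(\<lambda>t. ennpowr (g t) (q t)) \<in> borel_measurable M"
  unfolding ennpowr_def by measurable

lemma var_norm_mono:
  assumes "\<And>t. t \<in> space M \<Longrightarrow> g t \<le> h t" "\<And>t. 0 \<le> q t"
  shows "var_norm M q g \<le> var_norm M q h"
  unfolding var_norm_def
proof (rule Inf_mono, clarify)
  fix s :: real assume s: "0 < s" "(\<integral>\<^sup>+ t. ennpowr (h t / ennreal s) (q t) \<partial>M) \<le> 1"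
  have "(\<integral>\<^sup>+ t. ennpowr (g t / ennreal s) (q t) \<partial>M) \<le> (\<integral>\<^sup>+ t. ennpowr (h t / ennreal s) (q t) \<partial>M)"
    using assms by (intro nn_integral_mono ennpowr_mono divide_right_mono_ennreal) auto
  with s show "\<exists>a\<in>{ennreal s |s. 0 < s \<and> (\<integral>\<^sup>+ t. ennpowr (g t / ennreal s) (q t) \<partial>M) \<le> 1}. a \<le> ennreal s"
    by (intro bexI[of _ "ennreal s"]) (auto intro: order_trans)
qed

text \<open>Reduces a norm inequality to an implication between modulars: each \<open>s\<close>
  admissible for \<open>h\<close> makes \<open>C * s\<close> admissible for \<open>g\<close>. The
  constant is put on the left as \<open>1 / C\<close> so that the right-hand side is a bare
  infimum.\<close>

lemma var_norm_le_cmult: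
  assumes C: "0 < C"
    and le: "\<And>s. 0 < s \<Longrightarrow> (\<integral>\<^sup>+ t. ennpowr (h t / ennreal s) (q t) \<partial>M) \<le> 1 \<Longrightarrow>
      (\<integral>\<^sup>+ t. ennpowr (g t / ennreal (C * s)) (q t) \<partial>M) \<le> 1"
  shows "var_norm M q g \<le> ennreal C * var_norm M q h"
proof -
  have "ennreal (1 / C) * var_norm M q g \<le> var_norm M q h"
    unfolding var_norm_def[of M q h]
  proof (rule Inf_greatest, clarify)
    fix s :: real assume s: "0 < s" "(\<integral>\<^sup>+ t. ennpowr (h t / ennreal s) (q t) \<partial>M) \<le> 1"
    have "var_norm M q g \<le> ennreal (C * s)"
      unfolding var_norm_def using le[OF s] s C by (intro Inf_lower) auto
    then have "ennreal (1 / C) * var_norm M q g \<le> ennreal (1 / C) * ennreal (C * s)"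
      by (intro mult_left_mono) auto
    then show "ennreal (1 / C) * var_norm M q g \<le> ennreal s"
      using C by (simp add: ennreal_mult'[symmetric])
  qed
  then have "ennreal C * (ennreal (1 / C) * var_norm M q g) \<le> ennreal C * var_norm M q h"
    by (intro mult_left_mono) auto
  then show ?thesis
    using C by (simp add: mult.assoc[symmetric] ennreal_mult'[symmetric])
qed

lemma var_norm_lt_top_iff:
  "var_norm M q g < \<infinity> \<longleftrightarrow> (\<exists>s>0. (\<integral>\<^sup>+ t. ennpowr (g t / ennreal s) (q t) \<partial>M) \<le> 1)"
  unfolding var_norm_def by (auto simp: Inf_less_iff)

text \<open>The extra weight \<open>t powr (- (1 / q t))\<close>, raised to the power
  \<open>q t\<close>, is exactly the density \<open>1 / t\<close>.\<close>

lemma var_norm_dt_measure: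
  fixes q :: "real \<Rightarrow> real" and R :: "real \<Rightarrow> ennreal"
  assumes [measurable]: "q \<in> borel_measurable lebesgue" and q1: "\<And>t. 1 \<le> q t"
    and R: "R \<in> borel_measurable borel"
  shows "var_norm dt_measure q (\<lambda>t. ennreal (t powr (a - 1 / q t)) * R t)
    = var_norm dt_over_t_measure q (\<lambda>t. ennreal (t powr a) * R t)"
proof -
  have [measurable]: "R \<in> borel_measurable lebesgue" using R by (simp add: measurable_completion)
  have "(\<integral>\<^sup>+ t. ennpowr (ennreal (t powr (a - 1 / q t)) * R t / ennreal s) (q t) \<partial>dt_measure) =
     (\<integral>\<^sup>+ t. ennpowr (ennreal (t powr a) * R t / ennreal s) (q t) \<partial>dt_over_t_measure)" for s
  proof -
    have "(\<integral>\<^sup>+ t. ennpowr (ennreal (t powr (a - 1 / q t)) * R t / ennreal s) (q t) \<partial>dt_measure) =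
      (\<integral>\<^sup>+ t. ennpowr (ennreal (t powr (a - 1 / q t)) * R t / ennreal s) (q t) * indicator {0..} t \<partial>lebesgue)"
      unfolding dt_measure_def by (subst nn_integral_restrict_space) auto
    also have "\<dots> = (\<integral>\<^sup>+ t. ennreal (1 / t) * ennpowr (ennreal (t powr a) * R t / ennreal s) (q t) \<partial>lebesgue)"
    proof (intro nn_integral_cong)
      fix t :: real
      consider "t < 0" | "t = 0" | "0 < t" by linarith
      then show "ennpowr (ennreal (t powr (a - 1 / q t)) * R t / ennreal s) (q t) * indicator {0..} t
          = ennreal (1 / t) * ennpowr (ennreal (t powr a) * R t / ennreal s) (q t)"
      proof cases
        case 3
        have q0: "q t \<noteq> 0" using q1[of t] by simp
        have "t powr (a - 1 / q t) = t powr (- (1 / q t)) * t powr a"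
          by (simp add: powr_add[symmetric])
        then have "ennreal (t powr (a - 1 / q t)) * R t / ennreal s
          = ennreal (t powr (- (1 / q t))) * (ennreal (t powr a) * R t / ennreal s)"
          by (simp add: ennreal_mult' mult.assoc ennreal_times_divide)
        then show ?thesis
          using 3 q0 by (simp add: ennpowr_cmult powr_powr)
      \<comment> \<open>For \<open>t < 0\<close> the indicator and \<open>ennreal (1 / t)\<close>
        vanish; at \<open>t = 0\<close> both sides are 0 since \<open>0 powr x = 0\<close> and
        \<open>1 / 0 = 0\<close>.\<close>
      qed (simp_all add: ennreal_neg ennpowr_def)
    qed
    also have "\<dots> = (\<integral>\<^sup>+ t. ennpowr (ennreal (t powr a) * R t / ennreal s) (q t) \<partial>dt_over_t_measure)"
    proof -
      have [measurable]: "(\<lambda>t::real. t powr a) \<in> borel_measurable lebesgue"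
        by (intro measurable_completion) measurable
      show ?thesis by (subst nn_integral_dt_over_t) measurable
    qed
    finally show ?thesis .
  qed
  then show ?thesis unfolding var_norm_def by simp
qed

section \<open>From the modular of the rearrangement to that of the
  \<open>K\<close>-functional\<close>

text \<open>If the bound failed at \<open>t\<close>, then by monotonicity of \<open>R\<close> the integrand would be at least \<open>4\<close> on
  \<open>[t/2, t]\<close>, a set of \<open>dt/t\<close>-measure at least \<open>1/2\<close>.\<close>

lemma modular_antimono_bound:
  fixes q :: "real \<Rightarrow> real" and R :: "real \<Rightarrow> ennreal"
  assumes q1: "\<And>t. 1 \<le> q t" and R: "\<And>u t. u \<le> t \<Longrightarrow> R t \<le> R u"
    and a: "0 \<le> a" "a \<le> 1" and s: "0 < s" and t: "0 < t"
    and mod: "(\<integral>\<^sup>+ t. ennpowr (ennreal (t powr a) * R t / ennreal s) (q t) \<partial>dt_over_t_measure) \<le> 1"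
  shows "ennreal (t powr a) * R t \<le> ennreal (8 * s)"
proof (rule ccontr)
  assume "\<not> ?thesis"
  then have gt: "ennreal (8 * s) \<le> ennreal (t powr a) * R t" by simp
  have four: "4 \<le> ennpowr (ennreal (u powr a) * R u / ennreal s) (q u)" if u: "t / 2 \<le> u" "u \<le> t" for u
  proof -
    \<comment> \<open>Because \<open>a \<le> 1\<close>, replacing \<open>t\<close> by some
      \<open>u \<ge> t / 2\<close> costs the weight at most a factor 2, which turns the constant 8
      into 4. Then \<open>q u \<ge> 1\<close> keeps the power at least 4.\<close>
    have "(1 / 2) powr 1 \<le> (1 / 2 :: real) powr a" using a by (intro powr_mono') auto
    then have "1 / 2 * t powr a \<le> (1 / 2) powr a * t powr a" by (intro mult_right_mono) auto
    also have "\<dots> = (t / 2) powr a" using t by (subst powr_mult[symmetric]) auto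
    also have "\<dots> \<le> u powr a" using u t a by (intro powr_mono2) auto
    finally have ua: "1 / 2 * t powr a \<le> u powr a" .
    have "ennreal (4 * s) = ennreal (1 / 2) * ennreal (8 * s)" using s by (subst ennreal_mult'[symmetric]) auto
    also have "\<dots> \<le> ennreal (1 / 2) * (ennreal (t powr a) * R t)" using gt by (intro mult_left_mono) auto
    also have "\<dots> = ennreal (1 / 2 * t powr a) * R t" by (subst ennreal_mult') (auto simp: mult.assoc)
    also have "\<dots> \<le> ennreal (u powr a) * R u" using ua u by (intro mult_mono ennreal_leI R) auto
    finally have "ennreal (4 * s) / ennreal s \<le> ennreal (u powr a) * R u / ennreal s"
      by (rule divide_right_mono_ennreal)
    then have "ennreal 4 \<le> ennreal (u powr a) * R u / ennreal s" using s by (simp add: divide_ennreal)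
    then have "ennpowr (ennreal 4) (q u) \<le> ennpowr (ennreal (u powr a) * R u / ennreal s) (q u)"
      using q1[of u] by (intro ennpowr_mono) auto
    moreover have "(4::real) powr 1 \<le> 4 powr q u" using q1 by (intro powr_mono) auto
    then have "ennreal 4 \<le> ennpowr (ennreal 4) (q u)" by (subst ennpowr_ennreal) (auto intro: ennreal_leI)
    ultimately show ?thesis by simp
  qed
  \<comment> \<open>The interval has length \<open>t / 2\<close> and
    \<open>1 / u \<ge> 1 / t\<close> on it, so the modular would be at least 2.\<close>
  have "2 = (\<integral>\<^sup>+ u. ennreal (4 / t) * indicator {t / 2..t} u \<partial>lebesgue)"
    using t by (subst nn_integral_cmult_indicator) (auto simp: ennreal_mult'[symmetric])
  also have "\<dots> \<le> (\<integral>\<^sup>+ u. ennreal (1 / u) * (4 * indicator {t / 2..t} u) \<partial>lebesgue)"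
    using t by (intro nn_integral_mono)
       (auto simp: indicator_def ennreal_mult''[symmetric] field_simps intro!: ennreal_leI simp flip: ennreal_numeral)
  also have "\<dots> = (\<integral>\<^sup>+ u. 4 * indicator {t / 2..t} u \<partial>dt_over_t_measure)"
    by (intro nn_integral_dt_over_t[symmetric] borel_measurable_times_ennreal
        borel_measurable_const borel_measurable_indicator) simp
  also have "\<dots> \<le> (\<integral>\<^sup>+ t. ennpowr (ennreal (t powr a) * R t / ennreal s) (q t) \<partial>dt_over_t_measure)"
    using four by (intro nn_integral_mono) (auto simp: indicator_def)
  also have "\<dots> \<le> 1" by fact
  finally show False by simp
qed

text \<open>With \<open>\<sigma>\<close> chosen such that
  \<open>\<sigma> ^ 2 = 2 powr (- \<theta>)\<close>, the dyadic sum bounding the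
  \<open>K\<close>-functional becomes \<open>16 * s * t powr \<theta>\<close> times the Hardy sum of
  the normalised function \<open>G\<close>. The factor 2 in that bound yields 32, and
  \<open>C\<close> comes from the Hardy inequality.\<close>

lemma modular_K_functional_le:
  fixes \<theta> C qinf :: real and q :: "real \<Rightarrow> real" and f :: "real ^ 'n \<Rightarrow> 'b::{banach, second_countable_topology}"
  defines "\<sigma> \<equiv> 2 powr (- \<theta> / 2)"
  assumes \<theta>: "0 < \<theta>" "\<theta> < 1" and q1: "\<And>t. 1 \<le> q t"
    and C: "0 < C"
      "\<forall>G. G \<in> borel_measurable borel \<longrightarrow> (\<forall>t>0. 0 \<le> G t \<and> G t \<le> 1) \<longrightarrow>
        (\<integral>\<^sup>+ t. ennreal (G t powr q t) \<partial>dt_over_t_measure) \<le> 1 \<longrightarrow>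
        (\<integral>\<^sup>+ t. ennreal (((\<Sum>k. \<sigma> ^ (2 * Suc k) * G (t / 2 ^ Suc k)) / C) powr q t) \<partial>dt_over_t_measure) \<le> 1"
    and f: "f \<in> borel_measurable lebesgue" and s: "0 < s"
    and mod: "(\<integral>\<^sup>+ t. ennpowr (ennreal (t powr (1 - \<theta>)) * rearrangement f t / ennreal s) (q t)
        \<partial>dt_over_t_measure) \<le> 1"
  shows "(\<integral>\<^sup>+ t. ennpowr (ennreal (t powr (- \<theta>)) * K_functional L1_space Linf_space t f / ennreal (32 * C * s)) (q t)
        \<partial>dt_over_t_measure) \<le> 1"
    and "f \<in> sum_carrier L1_space Linf_space"
proof -
  have \<sigma>: "0 < \<sigma>" "\<sigma> < 1" using \<theta> by (auto simp: \<sigma>_def powr_less_one)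
  \<comment> \<open>The divisor \<open>8 * s\<close> is the bound from
    \<open>modular_antimono_bound\<close>, so \<open>G \<le> 1\<close> on the positive
    half-line.\<close>
  define G where "G t = enn2real (rearrangement f t) * t powr (1 - \<theta>) / (8 * s)" for t
  have bound: "ennreal (t powr (1 - \<theta>)) * rearrangement f t \<le> ennreal (8 * s)" if "0 < t" for t
    using that \<theta> s q1 mod by (intro modular_antimono_bound[of q]) (auto intro: rearrangement_antimono)
  have fin: "rearrangement f t < \<infinity>" if "0 < t" for t
  proof (rule ccontr)
    assume "\<not> rearrangement f t < \<infinity>"
    then show False using bound[OF that] that by (simp add: less_top[symmetric] ennreal_mult_top top_unique)
  qed
  then have R: "rearrangement f t = ennreal (enn2real (rearrangement f t))" if "0 < t" for t
    using that by auto
  have G_eq: "ennreal (t powr (1 - \<theta>)) * rearrangement f t = ennreal (8 * s * G t)" if "0 < t" for t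
    using s by (subst R[OF that]) (simp add: G_def ennreal_mult'[symmetric] mult.commute)
  have G0: "0 \<le> G t" for t using s by (simp add: G_def)
  have G1: "G t \<le> 1" if "0 < t" for t
    using bound[OF that] s unfolding G_eq[OF that] by (simp add: ennreal_le_iff)
  have G: "G \<in> borel_measurable borel" unfolding G_def by measurable
  have modG: "(\<integral>\<^sup>+ t. ennreal (G t powr q t) \<partial>dt_over_t_measure) \<le> 1"
  proof (rule order_trans[OF nn_integral_mono mod])
    fix t assume "t \<in> space dt_over_t_measure"
    then have t: "0 < t" by (simp add: space_dt_over_t)
    \<comment> \<open>\<open>G\<close> was divided by \<open>8 * s\<close> and the given modular
      only by \<open>s\<close>, so the modular of \<open>G\<close> is no larger.\<close>
    have "ennreal (G t) \<le> ennreal (8 * s * G t) / ennreal s"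
      using G0[of t] s by (simp add: divide_ennreal ennreal_leI)
    then have "ennpowr (ennreal (G t)) (q t) \<le> ennpowr (ennreal (8 * s * G t) / ennreal s) (q t)"
      using q1[of t] by (intro ennpowr_mono) auto
    then show "ennreal (G t powr q t) \<le> ennpowr (ennreal (t powr (1 - \<theta>)) * rearrangement f t / ennreal s) (q t)"
      using G0 by (simp add: G_eq[OF t] ennpowr_ennreal)
  qed
  define H where "H t = (\<Sum>k. \<sigma> ^ (2 * Suc k) * G (t / 2 ^ Suc k))" for t
  have S: "(\<Sum>k. ennreal (t / 2 ^ k) * rearrangement f (t / 2 ^ Suc k)) = ennreal (16 * s * t powr \<theta> * H t)"
    and H0: "0 \<le> H t" if t: "0 < t" for t
  proof -
    have pos: "0 < t / 2 ^ Suc k" for k using t by simp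
    have sm: "summable (\<lambda>k. \<sigma> ^ (2 * Suc k) * G (t / 2 ^ Suc k))"
      using suminf_powr_le(2)[where b = 1 and g = "\<lambda>k. G (t / 2 ^ Suc k)", OF \<sigma> _ G0 G1[OF pos]] by simp
    show "0 \<le> H t" unfolding H_def using G0 \<sigma> by (intro suminf_nonneg sm) auto
    have "ennreal (t / 2 ^ k) * rearrangement f (t / 2 ^ Suc k)
      = ennreal (16 * s * t powr \<theta> * (\<sigma> ^ (2 * Suc k) * G (t / 2 ^ Suc k)))" for k
    proof -
      define u where "u = t / 2 ^ Suc k"
      \<comment> \<open>The term of index \<open>k\<close> evaluates the rearrangement at
        \<open>u\<close> but has coefficient \<open>2 * u\<close>; this doubles the 8 in
        \<open>G\<close> to 16.\<close>
      have u: "0 < u" "t / 2 ^ k = 2 * u" using t by (auto simp: u_def)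
      have "\<sigma> ^ (2 * Suc k) = (2 powr (- \<theta>)) ^ Suc k"
        unfolding \<sigma>_def power_mult by (simp add: power2_eq_square powr_add[symmetric])
      also have "\<dots> = (1 / 2 ^ Suc k) powr \<theta>"
        by (subst powr_realpow[symmetric], simp, subst powr_powr)
           (simp add: powr_divide powr_realpow[symmetric] powr_powr powr_minus_divide mult.commute del: power_Suc of_nat_Suc)
      finally have "t powr \<theta> * \<sigma> ^ (2 * Suc k) = u powr \<theta>"
        using t by (simp add: u_def powr_divide del: power_Suc)
      moreover have "u powr \<theta> * u powr (1 - \<theta>) = u" using u by (simp add: powr_add[symmetric])
      then have "16 * s * u powr \<theta> * G u = 2 * u * enn2real (rearrangement f u)"
        using s by (simp add: G_def)
      ultimately have "16 * s * t powr \<theta> * (\<sigma> ^ (2 * Suc k) * G u) = 2 * u * enn2real (rearrangement f u)"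
        by (metis mult.assoc)
      then show ?thesis
        unfolding u_def[symmetric] u(2) by (subst R[OF u(1)]) (simp only: ennreal_mult''[OF enn2real_nonneg])
    qed
    then have "(\<Sum>k. ennreal (t / 2 ^ k) * rearrangement f (t / 2 ^ Suc k))
      = (\<Sum>k. ennreal (16 * s * t powr \<theta> * (\<sigma> ^ (2 * Suc k) * G (t / 2 ^ Suc k))))"
      by (simp only:)
    also have "\<dots> = ennreal (\<Sum>k. 16 * s * t powr \<theta> * (\<sigma> ^ (2 * Suc k) * G (t / 2 ^ Suc k)))"
      using G0 \<sigma> s by (intro suminf_ennreal2 summable_mult sm) auto
    also have "\<dots> = ennreal (16 * s * t powr \<theta> * H t)"
      unfolding H_def by (simp only: suminf_mult[OF sm])
    finally show "(\<Sum>k. ennreal (t / 2 ^ k) * rearrangement f (t / 2 ^ Suc k))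
      = ennreal (16 * s * t powr \<theta> * H t)" .
  qed
  note K = K_functional_le_rearrangement[OF f fin]
  \<comment> \<open>Finiteness of the dyadic sum at the single value \<open>t = 1\<close> already
    gives a decomposition.\<close>
  show "f \<in> sum_carrier L1_space Linf_space"
    by (rule K(2)[of 1]) (simp_all only: S zero_less_one ennreal_less_top infinity_ennreal_def)
  have "(\<integral>\<^sup>+ t. ennpowr (ennreal (t powr (- \<theta>)) * K_functional L1_space Linf_space t f / ennreal (32 * C * s)) (q t)
        \<partial>dt_over_t_measure)
    \<le> (\<integral>\<^sup>+ t. ennreal ((H t / C) powr q t) \<partial>dt_over_t_measure)"
  proof (rule nn_integral_mono)
    fix t assume "t \<in> space dt_over_t_measure"
    then have t: "0 < t" by (simp add: space_dt_over_t)
    have "K_functional L1_space Linf_space t f \<le> 2 * ennreal (16 * s * t powr \<theta> * H t)"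
      using K(1)[OF _ t] unfolding S[OF t] by (simp only: ennreal_less_top infinity_ennreal_def)
    then have "ennreal (t powr (- \<theta>)) * K_functional L1_space Linf_space t f
      \<le> ennreal (t powr (- \<theta>)) * (2 * ennreal (16 * s * t powr \<theta> * H t))"
      by (intro mult_left_mono) auto
    also have "\<dots> = ennreal (t powr (- \<theta>) * (2 * (16 * s * t powr \<theta> * H t)))"
    proof -
      have "2 * ennreal (16 * s * t powr \<theta> * H t) = ennreal (2 * (16 * s * t powr \<theta> * H t))"
        by (subst ennreal_mult') simp_all
      then show ?thesis by (simp only: ennreal_mult'[OF powr_ge_zero])
    qed
    also have "t powr (- \<theta>) * (2 * (16 * s * t powr \<theta> * H t)) = 32 * s * H t"
      using t by (simp add: powr_minus_divide)
    finally have "ennreal (t powr (- \<theta>)) * K_functional L1_space Linf_space t f / ennreal (32 * C * s)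
       \<le> ennreal (32 * s * H t) / ennreal (32 * C * s)"
      by (rule divide_right_mono_ennreal)
    also have "\<dots> = ennreal (H t / C)" using s C H0[OF t] by (simp add: divide_ennreal)
    finally have "ennpowr (ennreal (t powr (- \<theta>)) * K_functional L1_space Linf_space t f / ennreal (32 * C * s)) (q t)
       \<le> ennpowr (ennreal (H t / C)) (q t)"
      using q1[of t] by (intro ennpowr_mono) auto
    then show "ennpowr (ennreal (t powr (- \<theta>)) * K_functional L1_space Linf_space t f / ennreal (32 * C * s)) (q t)
       \<le> ennreal ((H t / C) powr q t)"
      using C H0[OF t] by (simp add: ennpowr_ennreal)
  qed
  also have "\<dots> \<le> 1" unfolding H_def
    by (rule C(2)[rule_format, OF G _ modG]) (use G0 G1 in simp)
  finally show "(\<integral>\<^sup>+ t. ennpowr (ennreal (t powr (- \<theta>)) * K_functional L1_space Linf_space t f / ennreal (32 * C * s)) (q t)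
        \<partial>dt_over_t_measure) \<le> 1" .
qed

section \<open>Equality of the interpolation space and the Lorentz space\<close>

lemma sum_carrier_L1_Linf_measurable:
  assumes "f \<in> sum_carrier L1_space Linf_space"
  shows "f \<in> borel_measurable lebesgue"
proof -
  obtain f0 f1 where f: "f = f0 + f1" "integrable lebesgue f0" "f1 \<in> borel_measurable lebesgue"
    using assms by (auto simp: sum_carrier_def L1_space_def Linf_space_def Let_def)
  then have "(\<lambda>x. f0 x + f1 x) \<in> borel_measurable lebesgue" by (intro borel_measurable_add) auto
  then show ?thesis unfolding f plus_fun_def .
qed

theorem theorem7:
  fixes \<theta> qinf :: real and q :: "real \<Rightarrow> real"
  assumes "0 < \<theta>" and "\<theta> < 1"
    and "q \<in> exponents"
    and "log_hoelder_origin q"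
    and "log_hoelder_infinity q qinf"
    and "q 0 = qinf"
  shows "same_space
     (var_interp (L1_space :: (real ^ 'n \<Rightarrow> 'b::{real_normed_field, banach, second_countable_topology}) nspace)
        Linf_space \<theta> q)
     (var_lorentz (\<lambda>_. 1 / (1 - \<theta>)) q)"
proof -
  let ?K = "K_functional (L1_space :: (real ^ 'n \<Rightarrow> 'b) nspace) Linf_space"
  define I where "I f = var_norm dt_over_t_measure q (\<lambda>t. ennreal (t powr (- \<theta>)) * ?K t f)"
    for f :: "real ^ 'n \<Rightarrow> 'b"
  define L where "L f = var_norm dt_over_t_measure q (\<lambda>t. ennreal (t powr (1 - \<theta>)) * rearrangement f t)"
    for f :: "real ^ 'n \<Rightarrow> 'b"
  have q: "q \<in> borel_measurable lebesgue" and q1: "1 \<le> q t" for t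
    using assms by (auto simp: exponents_def)
  have interp: "var_interp L1_space Linf_space \<theta> q = ({f \<in> sum_carrier L1_space Linf_space. I f < \<infinity>}, I)"
    unfolding I_def[abs_def] by (simp add: var_interp_def Let_def)
  have lorentz: "var_lorentz (\<lambda>_. 1 / (1 - \<theta>)) q = ({f \<in> borel_measurable lebesgue. L f < \<infinity>}, L)"
  proof -
    \<comment> \<open>Here \<open>1 / p = 1 - \<theta>\<close>, so both norms become Luxemburg norms
      for \<open>dt/t\<close>.\<close>
    have "var_norm dt_measure q (\<lambda>t. ennreal (t powr (1 / (1 / (1 - \<theta>)) - 1 / q t)) * rearrangement f t) = L f"
      for f :: "real ^ 'n \<Rightarrow> 'b"
      unfolding L_def using var_norm_dt_measure[OF q q1 borel_measurable_rearrangement] by simp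
    then show ?thesis by (simp add: var_lorentz_def Let_def)
  qed
  have LI: "L f \<le> I f" for f
    unfolding L_def I_def
  proof (rule var_norm_mono)
    fix t assume "t \<in> space dt_over_t_measure"
    then have t: "0 < t" by (simp add: space_dt_over_t)
    have "t powr (1 - \<theta>) = t powr (- \<theta>) * t" using t by (simp add: powr_diff powr_minus_divide)
    then have "ennreal (t powr (1 - \<theta>)) * rearrangement f t = ennreal (t powr (- \<theta>)) * (ennreal t * rearrangement f t)"
      by (simp add: ennreal_mult' mult.assoc)
    also have "\<dots> \<le> ennreal (t powr (- \<theta>)) * ?K t f"
      using t by (intro mult_left_mono rearrangement_le_K_functional) auto
    finally show "ennreal (t powr (1 - \<theta>)) * rearrangement f t \<le> ennreal (t powr (- \<theta>)) * ?K t f" .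
  qed (use q1 order_trans[OF zero_le_one] in blast)
  obtain c where c: "\<forall>t>0. \<bar>q t - qinf\<bar> * \<bar>ln t\<bar> \<le> c"
    using log_hoelder_imp_ln_bound[OF assms(4-6)] by blast
  have qinf: "1 \<le> qinf" using q1[of 0] assms(6) by simp
  have \<sigma>: "0 < 2 powr (- \<theta> / 2)" "2 powr (- \<theta> / 2) < 1"
    using assms(1) by (auto simp: powr_less_one)
  obtain C where C: "0 < C"
    "\<forall>G. G \<in> borel_measurable borel \<longrightarrow> (\<forall>t>0. 0 \<le> G t \<and> G t \<le> 1) \<longrightarrow>
      (\<integral>\<^sup>+ t. ennreal (G t powr q t) \<partial>dt_over_t_measure) \<le> 1 \<longrightarrow>
      (\<integral>\<^sup>+ t. ennreal (((\<Sum>k. (2 powr (- \<theta> / 2)) ^ (2 * Suc k) * G (t / 2 ^ Suc k)) / C) powr q t)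
        \<partial>dt_over_t_measure) \<le> 1"
    using hardy_modular[OF \<sigma> q q1 qinf c] by (elim exE conjE) (rule that)
  note modular = modular_K_functional_le[OF assms(1,2) q1 C]
  have IL: "I f \<le> ennreal (32 * C) * L f" if "f \<in> borel_measurable lebesgue" for f
    unfolding I_def L_def
  proof (rule var_norm_le_cmult)
    show "0 < 32 * C" using C by simp
  qed (rule modular(1)[OF that])
  \<comment> \<open>Membership in the sum of the two spaces is not part of the definition of the
    Lorentz space; it has to come from a finite norm.\<close>
  have sum: "f \<in> sum_carrier L1_space Linf_space" if f: "f \<in> borel_measurable lebesgue" "L f < \<infinity>" for f
  proof -
    obtain s where "0 < s" "(\<integral>\<^sup>+ t. ennpowr (ennreal (t powr (1 - \<theta>)) * rearrangement f t / ennreal s) (q t)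
        \<partial>dt_over_t_measure) \<le> 1"
      using f(2) unfolding L_def var_norm_lt_top_iff by blast
    then show ?thesis by (rule modular(2)[OF f(1)])
  qed
  have carrier: "{f \<in> sum_carrier L1_space Linf_space. I f < \<infinity>} = {f \<in> borel_measurable lebesgue. L f < \<infinity>}"
  proof (intro set_eqI iffI)
    fix f assume "f \<in> {f \<in> sum_carrier L1_space Linf_space. I f < \<infinity>}"
    then show "f \<in> {f \<in> borel_measurable lebesgue. L f < \<infinity>}"
      using le_less_trans[OF LI[of f]] sum_carrier_L1_Linf_measurable by blast
  next
    fix f assume f: "f \<in> {f \<in> borel_measurable lebesgue. L f < \<infinity>}"
    then have "ennreal (32 * C) * L f < \<infinity>" by (simp add: ennreal_mult_less_top)
    with f show "f \<in> {f \<in> sum_carrier L1_space Linf_space. I f < \<infinity>}"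
      using le_less_trans[OF IL[of f]] sum[of f] by blast
  qed
  show ?thesis
    unfolding same_space_def interp lorentz fst_conv snd_conv
  \<comment> \<open>The inequality \<open>L f \<le> I f\<close> needs the constant 1, the reverse
    one \<open>32 * C\<close>; the maximum serves both.\<close>
  proof (intro conjI exI[of _ "max 1 (32 * C)"] ballI carrier)
    fix f assume "f \<in> {f \<in> sum_carrier L1_space Linf_space. I f < \<infinity>}"
    then have "f \<in> borel_measurable lebesgue" using sum_carrier_L1_Linf_measurable by blast
    from IL[OF this] show "I f \<le> ennreal (max 1 (32 * C)) * L f"
      by (rule order_trans) (intro mult_right_mono ennreal_leI, auto)
    have "1 * L f \<le> ennreal (max 1 (32 * C)) * I f"
      by (intro mult_mono LI) (simp_all flip: ennreal_1 add: ennreal_leI)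
    then show "L f \<le> ennreal (max 1 (32 * C)) * I f" by simp
  qed simp
qed

end
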